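(* Let $\mathcal{A}$ be a unital complex Banach algebra. If $a,b\in\mathcal{A}^d$ are $\{a,b\}$-weakly commutative, then $ab\in\mathcal{A}^d$ and $(ab)^d=b^da^d$.
   Context: An element $x$ of the unital complex Banach algebra $\mathcal{A}$ is quasinilpotent if $\lim_{n\to\infty}\|x^n\|^{1/n}=0$; $\mathcal{A}^{qnil}$ is the set of quasinilpotent elements. An element $a\in\mathcal{A}$ is g-Drazin invertible if there is $a^d\in\mathcal{A}$ (the g-Drazin inverse of $a$, unique when it exists) with $aa^d=a^da$, $a^daa^d=a^d$ and $a-a^2a^d\in\mathcal{A}^{qnil}$; $\mathcal{A}^d$ is the set of g-Drazin invertible elements. Elements $a,b\in\mathcal{A}$ are $a$-weakly commutative if there is $c_1\in\mathcal{A}$ with $ab=c_1a$ and $ba=ac_1$; they are $b$-weakly commutative if there is $c_2\in\mathcal{A}$ with $ab=bc_2$ and $ba=c_2b$; they are $\{a,b\}$-weakly commutative if they are both $a$-weakly commutative and $b$-weakly commutative. *)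

theory Defs
  imports "HOL-Analysis.Analysis"
begin

text \<open>
  Unital complex Banach algebras. The real structure, the norm and completeness come from the
  library classes; \<open>scaleC\<close> extends the real scalar multiplication to the complex numbers.
  The class \<open>real_normed_algebra_1\<close> is avoided on purpose: it would add \<open>norm 1 = 1\<close>, while here
  the norm is only required to be complete and submultiplicative.
\<close>

class complex_banach_algebra_1 = real_algebra_1 + real_normed_algebra + banach +
  fixes scaleC :: "complex \<Rightarrow> 'a \<Rightarrow> 'a"  (infixr "*\<^sub>C" 75)
  assumes scaleC_add_right: "c *\<^sub>C (x + y) = c *\<^sub>C x + c *\<^sub>C y"
    and scaleC_add_left: "(c + d) *\<^sub>C x = c *\<^sub>C x + d *\<^sub>C x"
    and scaleC_scaleC: "c *\<^sub>C d *\<^sub>C x = (c * d) *\<^sub>C x"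
    and scaleC_of_real: "complex_of_real r *\<^sub>C x = r *\<^sub>R x"
    and mult_scaleC_left: "(c *\<^sub>C x) * y = c *\<^sub>C (x * y)"
    and mult_scaleC_right: "x * (c *\<^sub>C y) = c *\<^sub>C (x * y)"
    and norm_scaleC: "norm (c *\<^sub>C x) = cmod c * norm x"

definition quasinilpotent :: "'a::complex_banach_algebra_1 \<Rightarrow> bool" where
  "quasinilpotent x \<longleftrightarrow> (\<lambda>n. root n (norm (x ^ n))) \<longlonglongrightarrow> 0"

definition is_gDrazin_inverse :: "'a::complex_banach_algebra_1 \<Rightarrow> 'a \<Rightarrow> bool" where
  "is_gDrazin_inverse a x \<longleftrightarrow>
     a * x = x * a \<and> x * a * x = x \<and> quasinilpotent (a - a ^ 2 * x)"

definition gDrazin_invertible :: "'a::complex_banach_algebra_1 \<Rightarrow> bool" where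
  "gDrazin_invertible a \<longleftrightarrow> (\<exists>x. is_gDrazin_inverse a x)"

text \<open>Only meaningful for g-Drazin invertible elements, where the inverse is unique.\<close>

definition gDrazin_inverse :: "'a::complex_banach_algebra_1 \<Rightarrow> 'a" where
  "gDrazin_inverse a = (THE x. is_gDrazin_inverse a x)"

text \<open>
  \<open>weakly_commutative_left a b\<close> says that \<open>a\<close> and \<open>b\<close> are \<open>a\<close>-weakly commutative;
  \<open>weakly_commutative_right a b\<close> says that they are \<open>b\<close>-weakly commutative.
\<close>

definition weakly_commutative_left :: "'a::complex_banach_algebra_1 \<Rightarrow> 'a \<Rightarrow> bool" where
  "weakly_commutative_left a b \<longleftrightarrow> (\<exists>c. a * b = c * a \<and> b * a = a * c)"

definition weakly_commutative_right :: "'a::complex_banach_algebra_1 \<Rightarrow> 'a \<Rightarrow> bool" where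
  "weakly_commutative_right a b \<longleftrightarrow> (\<exists>c. a * b = b * c \<and> b * a = c * b)"

definition weakly_commutative :: "'a::complex_banach_algebra_1 \<Rightarrow> 'a \<Rightarrow> bool" where
  "weakly_commutative a b \<longleftrightarrow> weakly_commutative_left a b \<and> weakly_commutative_right a b"

end

theory Submission imports Defs begin

text \<open>
  Weak commutativity makes the squares commute: \<open>a * b = c * a\<close> and \<open>b * a = a * c\<close> give
  \<open>a\<^sup>2 b = a c a = b a\<^sup>2\<close>, and likewise \<open>b\<^sup>2\<close> commutes with \<open>a\<close>. A g-Drazin inverse \<open>x\<close> of \<open>a\<close>
  has the form \<open>x = x\<^sup>2 a\<close>, where \<open>x\<^sup>2\<close> is a g-Drazin inverse of \<open>a\<^sup>2\<close> and hence lies in the double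
  commutant of \<open>a\<^sup>2\<close> (\<open>gDrazin_inverse_commutes\<close>). So \<open>x\<^sup>2\<close>, \<open>y\<^sup>2\<close> and the spectral idempotents
  \<open>p = a x\<close>, \<open>e = b y\<close> commute with both \<open>a\<close> and \<open>b\<close>, where \<open>y\<close> is a g-Drazin inverse of \<open>b\<close>.
  All algebraic identities required of \<open>y x = x\<^sup>2 y\<^sup>2 b a\<close> follow by moving these elements to the
  front; both products of \<open>y x\<close> with \<open>a b\<close> equal \<open>p e\<close>.

  The remaining part of \<open>a b\<close> splits as
  \<open>a b (1 - p e) = (a (1 - p)) b + p (a (b (1 - e)))\<close>, and the two summands annihilate each other.
  Each summand is quasinilpotent, because a product of two weakly commuting elements, one of them
  quasinilpotent, is quasinilpotent: although such elements need not commute, the square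
  \<open>(a b)\<^sup>2 = (c b) a\<^sup>2\<close> is a product of commuting factors.
\<close>

section \<open>Quasinilpotent elements\<close>

text \<open>
  Quasinilpotence in the form of geometric bounds, which are stable under the algebraic
  operations below without any manipulation of roots. The constant \<open>C\<close> absorbs the exponent \<open>0\<close>,
  where \<open>norm 1\<close> is arbitrary and \<open>root 0\<close> is \<open>0\<close>.
\<close>

lemma quasinilpotent_iff_geometric_bound:
  fixes x :: "'a::complex_banach_algebra_1"
  shows "quasinilpotent x \<longleftrightarrow> (\<forall>r>0. \<exists>C. \<forall>n. norm (x ^ n) \<le> C * r ^ n)"
proof
  assume q: "quasinilpotent x"
  show "\<forall>r>0. \<exists>C. \<forall>n. norm (x ^ n) \<le> C * r ^ n"
  proof (intro allI impI)
    fix r :: real assume r: "r > 0"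
    have "eventually (\<lambda>n. root n (norm (x ^ n)) < r) sequentially"
      using q r unfolding quasinilpotent_def by (rule order_tendstoD(2))
    then obtain N where N: "\<And>n. n \<ge> N \<Longrightarrow> root n (norm (x ^ n)) < r"
      unfolding eventually_sequentially by blast
    define C where "C = 1 + (\<Sum>k\<le>N. norm (x ^ k) / r ^ k)"
    have "norm (x ^ n) \<le> C * r ^ n" for n
    proof (cases "n \<le> N")
      case True
      have "norm (x ^ n) / r ^ n \<le> (\<Sum>k\<le>N. norm (x ^ k) / r ^ k)"
        by (rule member_le_sum) (use True r in auto)
      then have "norm (x ^ n) / r ^ n \<le> C"
        unfolding C_def by linarith
      then show ?thesis using r by (simp add: field_simps)
    next
      case False
      then have n: "n > 0" "n \<ge> N" by auto
      have "norm (x ^ n) = root n (norm (x ^ n)) ^ n"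
        using n by (simp add: real_root_pow_pos2)
      also have "\<dots> \<le> r ^ n"
        by (intro power_mono) (use N[OF n(2)] n in auto)
      finally have le: "norm (x ^ n) \<le> r ^ n" .
      have "C \<ge> 1" unfolding C_def using r by (simp add: sum_nonneg)
      then have "1 * r ^ n \<le> C * r ^ n"
        using r by (intro mult_right_mono) auto
      with le show ?thesis by simp
    qed
    then show "\<exists>C. \<forall>n. norm (x ^ n) \<le> C * r ^ n" by blast
  qed
next
  assume bound: "\<forall>r>0. \<exists>C. \<forall>n. norm (x ^ n) \<le> C * r ^ n"
  show "quasinilpotent x"
    unfolding quasinilpotent_def
  proof (rule LIMSEQ_I)
    fix s :: real assume s: "s > 0"
    then obtain C where C: "\<And>n. norm (x ^ n) \<le> C * (s / 2) ^ n"
      using bound by (meson half_gt_zero)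
    obtain N where N: "C < 2 ^ N"
      using real_arch_pow[of 2 C] by auto
    have "norm (root n (norm (x ^ n)) - 0) < s" if n: "n \<ge> max 1 N" for n
    proof -
      have "(2::real) ^ N \<le> 2 ^ n" using n by (intro power_increasing) auto
      with N have "C < 2 ^ n" by linarith
      then have "C * (s / 2) ^ n < 2 ^ n * (s / 2) ^ n"
        using s by (intro mult_strict_right_mono) auto
      also have "\<dots> = s ^ n" by (simp flip: power_mult_distrib)
      finally have "norm (x ^ n) < s ^ n" using C[of n] by linarith
      then have "root n (norm (x ^ n)) < root n (s ^ n)"
        using n by (intro real_root_less_mono) auto
      also have "\<dots> = s" using n s by (intro real_root_power_cancel) auto
      finally show ?thesis using n by simp
    qed
    then show "\<exists>N. \<forall>n\<ge>N. norm (root n (norm (x ^ n)) - 0) < s" by blast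
  qed
qed

lemma quasinilpotent_geometric_boundE:
  fixes x :: "'a::complex_banach_algebra_1"
  assumes "quasinilpotent x" and "r > 0"
  obtains C where "\<And>n. norm (x ^ n) \<le> C * r ^ n" and "C > 0"
proof -
  obtain C where C: "\<And>n. norm (x ^ n) \<le> C * r ^ n"
    using assms quasinilpotent_iff_geometric_bound by blast
  have "norm (x ^ n) \<le> (\<bar>C\<bar> + 1) * r ^ n" for n
  proof -
    have "C * r ^ n \<le> (\<bar>C\<bar> + 1) * r ^ n"
      using assms(2) by (intro mult_right_mono) auto
    with C[of n] show ?thesis by linarith
  qed
  then show ?thesis using that[of "\<bar>C\<bar> + 1"] by auto
qed

lemma norm_power_le_geometric:
  fixes x :: "'a::complex_banach_algebra_1"
  shows "norm (x ^ n) \<le> norm (1::'a) * norm x ^ n"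
proof (induction n)
  case 0
  then show ?case by simp
next
  case (Suc n)
  have "norm (x ^ Suc n) \<le> norm x * norm (x ^ n)"
    by (simp add: norm_mult_ineq)
  also have "\<dots> \<le> norm x * (norm (1::'a) * norm x ^ n)"
    by (intro mult_left_mono Suc) auto
  finally show ?case by (simp add: mult_ac)
qed

lemma power_mult_distrib_commuting:
  fixes x y :: "'a::monoid_mult"
  assumes "x * y = y * x"
  shows "(x * y) ^ n = x ^ n * y ^ n"
proof (induction n)
  case 0
  then show ?case by simp
next
  case (Suc n)
  have "(x * y) ^ Suc n = x * (y * x ^ n) * y ^ n"
    by (simp add: Suc mult.assoc)
  also have "y * x ^ n = x ^ n * y"
    using power_commuting_commutes[OF assms, of n] by simp
  finally show ?case by (simp add: mult.assoc)
qed

lemma quasinilpotent_mult_commuting: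
  fixes x y :: "'a::complex_banach_algebra_1"
  assumes q: "quasinilpotent y" and comm: "x * y = y * x"
  shows "quasinilpotent (x * y)"
  unfolding quasinilpotent_iff_geometric_bound
proof (intro allI impI)
  fix r :: real assume r: "r > 0"
  define X where "X = norm x + 1"
  have X: "X > 0" "norm x \<le> X" unfolding X_def by (auto intro: add_nonneg_pos)
  obtain C where C: "\<And>n. norm (y ^ n) \<le> C * (r / X) ^ n" "C > 0"
    using quasinilpotent_geometric_boundE[OF q, of "r / X"] r X by auto
  have "norm ((x * y) ^ n) \<le> norm (1::'a) * C * r ^ n" for n
  proof -
    have "norm ((x * y) ^ n) \<le> norm (x ^ n) * norm (y ^ n)"
      by (simp add: power_mult_distrib_commuting[OF comm] norm_mult_ineq)
    also have "\<dots> \<le> (norm (1::'a) * X ^ n) * (C * (r / X) ^ n)"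
    proof (rule mult_mono)
      have "norm x ^ n \<le> X ^ n" using X by (intro power_mono) auto
      then have "norm (1::'a) * norm x ^ n \<le> norm (1::'a) * X ^ n"
        by (intro mult_left_mono) auto
      with norm_power_le_geometric[of x n] show "norm (x ^ n) \<le> norm (1::'a) * X ^ n"
        by linarith
    qed (use C X in auto)
    also have "\<dots> = norm (1::'a) * C * r ^ n"
      using X by (simp add: power_divide)
    finally show ?thesis .
  qed
  then show "\<exists>C. \<forall>n. norm ((x * y) ^ n) \<le> C * r ^ n" by blast
qed

lemma quasinilpotent_square_iff:
  fixes x :: "'a::complex_banach_algebra_1"
  shows "quasinilpotent (x ^ 2) \<longleftrightarrow> quasinilpotent x"
proof
  assume "quasinilpotent x"
  then show "quasinilpotent (x ^ 2)"
    using quasinilpotent_mult_commuting[of x x] by (simp add: power2_eq_square)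
next
  assume q: "quasinilpotent (x ^ 2)"
  show "quasinilpotent x"
    unfolding quasinilpotent_iff_geometric_bound
  proof (intro allI impI)
    fix r :: real assume r: "r > 0"
    obtain C where C: "\<And>n. norm ((x ^ 2) ^ n) \<le> C * (r ^ 2) ^ n" "C > 0"
      using quasinilpotent_geometric_boundE[OF q, of "r ^ 2"] r by auto
    define D where "D = C + norm x * C / r"
    have D: "C \<le> D" "norm x * C / r \<le> D" unfolding D_def using C r by auto
    have "norm (x ^ n) \<le> D * r ^ n" for n
    proof (cases "even n")
      case True
      then obtain k where k: "n = 2 * k" by (elim evenE)
      have "norm (x ^ n) \<le> C * r ^ n"
        using C(1)[of k] unfolding k by (simp add: power_mult)
      also have "\<dots> \<le> D * r ^ n" using D r by (intro mult_right_mono) auto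
      finally show ?thesis .
    next
      case False
      then obtain k where k: "n = 2 * k + 1" by (elim oddE)
      have "norm (x ^ n) \<le> norm x * norm ((x ^ 2) ^ k)"
        unfolding k by (simp add: power_mult norm_mult_ineq)
      also have "\<dots> \<le> norm x * (C * (r ^ 2) ^ k)"
        by (intro mult_left_mono C) auto
      also have "\<dots> = (norm x * C / r) * r ^ n"
        unfolding k using r by (simp add: power_mult)
      also have "\<dots> \<le> D * r ^ n" using D r by (intro mult_right_mono) auto
      finally show ?thesis .
    qed
    then show "\<exists>C. \<forall>n. norm (x ^ n) \<le> C * r ^ n" by blast
  qed
qed

lemma quasinilpotent_add_orthogonal:
  fixes u v :: "'a::complex_banach_algebra_1"
  assumes qu: "quasinilpotent u" and qv: "quasinilpotent v"
    and uv: "u * v = 0" and vu: "v * u = 0"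
  shows "quasinilpotent (u + v)"
  unfolding quasinilpotent_iff_geometric_bound
proof (intro allI impI)
  fix r :: real assume r: "r > 0"
  obtain C where C: "\<And>n. norm (u ^ n) \<le> C * r ^ n" "C > 0"
    using quasinilpotent_geometric_boundE[OF qu r] by auto
  obtain D where D: "\<And>n. norm (v ^ n) \<le> D * r ^ n" "D > 0"
    using quasinilpotent_geometric_boundE[OF qv r] by auto
  have pow: "(u + v) ^ Suc n = u ^ Suc n + v ^ Suc n" for n
  proof (induction n)
    case 0
    then show ?case by simp
  next
    case (Suc n)
    have "u * v ^ Suc n = 0" "v * u ^ Suc n = 0"
      using uv vu by (simp_all flip: mult.assoc)
    moreover have "(u + v) ^ Suc (Suc n) = (u + v) * (u ^ Suc n + v ^ Suc n)"
      using Suc by (metis power_Suc)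
    ultimately show ?case
      by (simp only: distrib_left distrib_right power_Suc) simp
  qed
  define E where "E = norm (1::'a) + C + D"
  have "norm ((u + v) ^ n) \<le> E * r ^ n" for n
  proof (cases n)
    case 0
    then show ?thesis unfolding E_def using C D by simp
  next
    case (Suc m)
    have "norm ((u + v) ^ n) \<le> norm (u ^ n) + norm (v ^ n)"
      unfolding Suc pow by (rule norm_triangle_ineq)
    also have "\<dots> \<le> (C + D) * r ^ n"
      using C(1)[of n] D(1)[of n] by (simp add: distrib_right)
    also have "\<dots> \<le> E * r ^ n"
      unfolding E_def using r by (intro mult_right_mono) auto
    finally show ?thesis .
  qed
  then show "\<exists>C. \<forall>n. norm ((u + v) ^ n) \<le> C * r ^ n" by blast
qed

lemma sandwich_fixed_point_eq_0:
  fixes s x t :: "'a::complex_banach_algebra_1"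
  assumes s: "s = x * s * t"
    and C: "\<And>n. norm (x ^ n) \<le> C * q ^ n" and D: "\<And>n. norm (t ^ n) \<le> D * r ^ n"
    and "\<bar>q * r\<bar> < 1"
  shows "s = 0"
proof -
  have iter: "s = x ^ n * s * t ^ n" for n
  proof (induction n)
    case 0
    then show ?case by simp
  next
    case (Suc n)
    have "x ^ Suc n * s * t ^ Suc n = x ^ n * (x * s * t) * t ^ n"
      by (simp add: mult.assoc power_Suc2[of x] del: power_Suc) (simp add: mult.assoc)
    then show ?case using Suc s by metis
  qed
  have "norm s \<le> C * norm s * D * (q * r) ^ n" for n
  proof -
    have "norm s \<le> norm (x ^ n) * norm s * norm (t ^ n)"
      by (subst iter[of n])
        (meson mult_right_mono norm_ge_zero norm_mult_ineq order_trans)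
    also have "\<dots> \<le> (C * q ^ n) * norm s * (D * r ^ n)"
      using order_trans[OF norm_ge_zero C[of n]] by (intro mult_mono C D) auto
    finally show ?thesis by (simp add: power_mult_distrib mult_ac)
  qed
  moreover have "(\<lambda>n. C * norm s * D * (q * r) ^ n) \<longlonglongrightarrow> C * norm s * D * 0"
    by (intro tendsto_mult tendsto_const LIMSEQ_power_zero) (use assms in auto)
  ultimately have "norm s \<le> C * norm s * D * 0"
    by (intro LIMSEQ_le_const) auto
  then show ?thesis by simp
qed

text \<open>
  Iterating the equation gives \<open>s = x\<^sup>n s t\<^sup>n\<close>, and the powers of a quasinilpotent factor decay
  faster than any geometric growth of those of the other. Applied to an idempotent \<open>p\<close>, this
  shows the vanishing of corners such as \<open>p c (1 - p)\<close>: it is the only analytic ingredient of the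
  double commutant property and of uniqueness.
\<close>

lemma quasinilpotent_sandwich_fixed_point_eq_0:
  fixes s x t :: "'a::complex_banach_algebra_1"
  assumes q: "quasinilpotent x \<or> quasinilpotent t" and s: "s = x * s * t"
  shows "s = 0"
proof -
  have small: "1 / (2 * (norm z + 1)) > 0" "\<bar>norm z * (1 / (2 * (norm z + 1)))\<bar> < 1"
    for z :: 'a
  proof -
    have "norm z + 1 > 0" by (intro add_nonneg_pos) auto
    then show "1 / (2 * (norm z + 1)) > 0" "\<bar>norm z * (1 / (2 * (norm z + 1)))\<bar> < 1"
      by (auto simp: abs_mult field_simps)
  qed
  from q show ?thesis
  proof
    assume "quasinilpotent x"
    then obtain C where "\<And>n. norm (x ^ n) \<le> C * (1 / (2 * (norm t + 1))) ^ n"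
      using quasinilpotent_geometric_boundE small(1) by blast
    then show ?thesis
      using small(2)[of t]
      by (intro sandwich_fixed_point_eq_0[OF s _ norm_power_le_geometric])
        (auto simp: mult.commute)
  next
    assume "quasinilpotent t"
    then obtain C where "\<And>n. norm (t ^ n) \<le> C * (1 / (2 * (norm x + 1))) ^ n"
      using quasinilpotent_geometric_boundE small(1) by blast
    then show ?thesis
      using small(2)[of x]
      by (intro sandwich_fixed_point_eq_0[OF s norm_power_le_geometric])
  qed
qed

section \<open>Products of weakly commuting elements\<close>

text \<open>
  The weak commutation relations let \<open>a\<^sup>2\<close> commute with both \<open>b\<close> and \<open>c\<close>, so that
  \<open>(a b)\<^sup>2 = (c b) a\<^sup>2\<close> is a product of commuting factors, one of them quasinilpotent.
\<close>

lemma quasinilpotent_mult_weakly_commutative_left: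
  fixes a b c :: "'a::complex_banach_algebra_1"
  assumes q: "quasinilpotent a" and ab: "a * b = c * a" and ba: "b * a = a * c"
  shows "quasinilpotent (a * b)"
proof -
  have "c * b * a ^ 2 = a ^ 2 * (c * b)"
    using ab ba by (metis mult.assoc power2_eq_square)
  then have "quasinilpotent ((c * b) * a ^ 2)"
    using q by (intro quasinilpotent_mult_commuting) (auto simp: quasinilpotent_square_iff)
  also have "(c * b) * a ^ 2 = (a * b) ^ 2"
    using ab ba by (metis mult.assoc power2_eq_square)
  finally show ?thesis by (simp only: quasinilpotent_square_iff)
qed

text \<open>Here the commuting factorisation is \<open>(a b)\<^sup>2 = (a c) b\<^sup>2\<close>.\<close>

lemma quasinilpotent_mult_weakly_commutative_right:
  fixes a b c :: "'a::complex_banach_algebra_1"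
  assumes q: "quasinilpotent b" and ab: "a * b = b * c" and ba: "b * a = c * b"
  shows "quasinilpotent (a * b)"
proof -
  have "a * c * b ^ 2 = b ^ 2 * (a * c)"
    using ab ba by (metis mult.assoc power2_eq_square)
  then have "quasinilpotent ((a * c) * b ^ 2)"
    using q by (intro quasinilpotent_mult_commuting) (auto simp: quasinilpotent_square_iff)
  also have "(a * c) * b ^ 2 = (a * b) ^ 2"
    using ab ba by (metis mult.assoc power2_eq_square)
  finally show ?thesis by (simp only: quasinilpotent_square_iff)
qed

section \<open>The g-Drazin inverse\<close>

lemma is_gDrazin_inverseD:
  assumes "is_gDrazin_inverse a x"
  shows "a * x = x * a" and "x * (a * x) = x" and "a * x * (a * x) = a * x"
    and "quasinilpotent (a - a ^ 2 * x)" and "a - a ^ 2 * x = a * (1 - a * x)"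
    and "a * (a * x) = a * x * a" and "x = x ^ 2 * a" and "a * x = x ^ 2 * (a * a)"
proof -
  show comm: "a * x = x * a" and "quasinilpotent (a - a ^ 2 * x)"
    using assms unfolding is_gDrazin_inverse_def by blast+
  show xax: "x * (a * x) = x"
    using assms unfolding is_gDrazin_inverse_def by (metis mult.assoc)
  show "a * x * (a * x) = a * x" using xax by (simp add: mult.assoc)
  show "a - a ^ 2 * x = a * (1 - a * x)"
    by (simp add: power2_eq_square right_diff_distrib mult.assoc)
  show "a * (a * x) = a * x * a" unfolding comm by (simp add: comm flip: mult.assoc)
  show sq: "x = x ^ 2 * a"
    using xax unfolding comm by (simp add: power2_eq_square mult.assoc)
  then show "a * x = x ^ 2 * (a * a)" unfolding comm by (metis mult.assoc)
qed

text \<open>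
  With \<open>p = a x\<close>, the corner \<open>p c (1 - p)\<close> equals \<open>x (p c (1 - p)) (a (1 - p))\<close> and so vanishes, as
  does \<open>(1 - p) c p\<close> symmetrically. Hence \<open>c\<close> commutes with \<open>p\<close>, and with \<open>x\<close>, which is the
  inverse of \<open>a\<close> in the corner of \<open>p\<close>.
\<close>

lemma gDrazin_inverse_commutes:
  fixes a x c :: "'a::complex_banach_algebra_1"
  assumes inv: "is_gDrazin_inverse a x" and ac: "a * c = c * a"
  shows "x * c = c * x"
proof -
  note D = is_gDrazin_inverseD[OF inv]
  define p where "p = a * x"
  define t where "t = a - a ^ 2 * x"
  have t: "quasinilpotent t" "t = a * (1 - p)"
    using D unfolding t_def p_def by auto
  have pp: "p * p = p" and pa: "p * a = a * p" and px: "p * x = x" and xp: "x * p = x"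
    and xa: "x * a = p"
    using D unfolding p_def by (auto simp: mult.assoc)
  have qq: "(1 - p) * (1 - p) = 1 - p"
    using pp by (simp add: algebra_simps)
  have qa: "(1 - p) * a = a * (1 - p)"
    using pa by (simp add: algebra_simps)
  have "x * (p * c * (1 - p)) * t = x * p * c * ((1 - p) * a) * (1 - p)"
    unfolding t by (simp add: mult.assoc)
  also have "\<dots> = x * (c * a) * ((1 - p) * (1 - p))"
    unfolding qa xp by (simp add: mult.assoc)
  also have "\<dots> = p * c * (1 - p)"
    unfolding qq ac[symmetric] by (simp add: xa flip: mult.assoc)
  finally have "p * c * (1 - p) = 0"
    using quasinilpotent_sandwich_fixed_point_eq_0 t(1) by metis
  then have 1: "p * c = p * c * p" by (simp add: right_diff_distrib)
  have "t * ((1 - p) * c * p) * x = a * ((1 - p) * (1 - p)) * c * (p * x)"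
    unfolding t by (simp add: mult.assoc)
  also have "\<dots> = (a * (1 - p)) * c * x"
    unfolding qq px ..
  also have "\<dots> = (1 - p) * (a * c) * x"
    unfolding qa[symmetric] by (simp add: mult.assoc)
  also have "\<dots> = (1 - p) * c * p"
    unfolding ac p_def by (simp add: mult.assoc)
  finally have "(1 - p) * c * p = 0"
    using quasinilpotent_sandwich_fixed_point_eq_0 t(1) by metis
  then have 2: "c * p = p * c * p" by (simp add: left_diff_distrib)
  have pc: "p * c = c * p" using 1 2 by simp
  have "x * c = x * (p * c)" using xp by (simp flip: mult.assoc)
  also have "\<dots> = x * (c * a) * x" unfolding pc by (simp add: p_def mult.assoc)
  also have "\<dots> = (p * c) * x" unfolding ac[symmetric] xa[symmetric] by (simp add: mult.assoc)
  also have "\<dots> = c * x" unfolding pc using px by (simp add: mult.assoc)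
  finally show ?thesis .
qed

text \<open>
  Two g-Drazin inverses of \<open>a\<close> have the same spectral idempotent: \<open>a x (1 - a y)\<close> is again a fixed
  point of a sandwich with the quasinilpotent \<open>a (1 - a y)\<close>, and the roles of \<open>x\<close> and \<open>y\<close> can be
  exchanged. Both are then the inverse of \<open>a\<close> in the same corner.
\<close>

lemma gDrazin_inverse_unique:
  fixes a x y :: "'a::complex_banach_algebra_1"
  assumes x: "is_gDrazin_inverse a x" and y: "is_gDrazin_inverse a y"
  shows "x = y"
proof -
  have idem: "a * x = a * x * (a * y)"
    if x: "is_gDrazin_inverse a x" and y: "is_gDrazin_inverse a y" for x y
  proof -
    note X = is_gDrazin_inverseD[OF x] and Y = is_gDrazin_inverseD[OF y]
    have qq: "(1 - a * y) * (1 - a * y) = 1 - a * y"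
      using Y(3) by (simp add: algebra_simps)
    have qa: "(1 - a * y) * a = a * (1 - a * y)"
      using Y(6) by (simp add: algebra_simps)
    have "x * (a * x * (1 - a * y)) * (a - a ^ 2 * y)
        = x * (a * x) * ((1 - a * y) * a) * (1 - a * y)"
      unfolding Y(5) by (simp add: mult.assoc)
    also have "\<dots> = x * a * ((1 - a * y) * (1 - a * y))"
      unfolding qa X(2) by (simp add: mult.assoc)
    also have "\<dots> = a * x * (1 - a * y)"
      unfolding qq X(1) ..
    finally have "a * x * (1 - a * y) = 0"
      using quasinilpotent_sandwich_fixed_point_eq_0 Y(4) by metis
    then show ?thesis by (simp add: right_diff_distrib)
  qed
  note X = is_gDrazin_inverseD[OF x] and Y = is_gDrazin_inverseD[OF y]
  have ax: "a * (a * y) = (a * y) * a" using Y(6) .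
  have "x * (a * y) = (a * y) * x"
    by (rule gDrazin_inverse_commutes[OF x ax])
  then have "a * x * (a * y) = a * y * (a * x)"
    using ax by (metis mult.assoc)
  then have eq: "a * x = a * y" using idem[OF x y] idem[OF y x] by simp
  have "x = x * (a * y)" using X(2) eq by simp
  also have "\<dots> = (a * y) * y" using X(1) eq by (metis mult.assoc)
  also have "\<dots> = y" using Y by (metis mult.assoc)
  finally show ?thesis .
qed

lemma gDrazin_inverse_eqI:
  assumes "is_gDrazin_inverse a x"
  shows "gDrazin_inverse a = x"
  unfolding gDrazin_inverse_def
  using assms gDrazin_inverse_unique by blast

lemma is_gDrazin_inverse_square:
  fixes a x :: "'a::complex_banach_algebra_1"
  assumes inv: "is_gDrazin_inverse a x"
  shows "is_gDrazin_inverse (a ^ 2) (x ^ 2)"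
proof -
  note D = is_gDrazin_inverseD[OF inv]
  have ax2: "a ^ 2 * x ^ 2 = a * x"
    using D(1,3) by (simp add: power2_eq_square mult.assoc) (metis mult.assoc)
  have xa2: "x ^ 2 * a ^ 2 = a * x"
    using D(1,3) by (simp add: power2_eq_square mult.assoc) (metis mult.assoc)
  have "x ^ 2 * a ^ 2 * x ^ 2 = x ^ 2"
    unfolding xa2 using D(1,2) by (simp add: power2_eq_square) (metis mult.assoc)
  moreover have "a ^ 2 - (a ^ 2) ^ 2 * x ^ 2 = (a - a ^ 2 * x) ^ 2"
  proof -
    have "(a - a ^ 2 * x) ^ 2 = a * ((1 - a * x) * a) * (1 - a * x)"
      unfolding D(5) by (simp add: power2_eq_square mult.assoc)
    also have "(1 - a * x) * a = a * (1 - a * x)"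
      using D(6) by (simp add: algebra_simps)
    also have "a * (a * (1 - a * x)) * (1 - a * x) = a ^ 2 * ((1 - a * x) * (1 - a * x))"
      by (simp add: power2_eq_square mult.assoc)
    also have "(1 - a * x) * (1 - a * x) = 1 - a ^ 2 * x ^ 2"
      using D(3) unfolding ax2 by (simp add: algebra_simps)
    finally show ?thesis by (simp add: right_diff_distrib power2_eq_square mult.assoc)
  qed
  ultimately show ?thesis
    using D(4) ax2 xa2 unfolding is_gDrazin_inverse_def
    by (simp add: quasinilpotent_square_iff)
qed

text \<open>
  Commuting with \<open>a\<^sup>2\<close> is enough for commuting with the spectral idempotent \<open>a x = a\<^sup>2 x\<^sup>2\<close>, although
  not for commuting with \<open>a\<close> or \<open>x\<close>.
\<close>

lemma gDrazin_inverse_commutes_square: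
  fixes a x c :: "'a::complex_banach_algebra_1"
  assumes inv: "is_gDrazin_inverse a x" and ac: "a ^ 2 * c = c * a ^ 2"
  shows "x ^ 2 * c = c * x ^ 2" and "a * x * c = c * (a * x)"
proof -
  show xc: "x ^ 2 * c = c * x ^ 2"
    by (rule gDrazin_inverse_commutes[OF is_gDrazin_inverse_square[OF inv] ac])
  have "a * x = x ^ 2 * a ^ 2"
    using is_gDrazin_inverseD(8)[OF inv] by (simp add: power2_eq_square)
  then show "a * x * c = c * (a * x)"
    using xc ac by (metis mult.assoc)
qed

section \<open>The reverse order law\<close>

text \<open>
  The elements \<open>P = x\<^sup>2\<close>, \<open>Q = y\<^sup>2\<close>, \<open>p = a x\<close> and \<open>e = b y\<close> of the proof commute with \<open>a\<close> and \<open>b\<close>. In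
  addition \<open>p\<close> commutes with \<open>c\<close> and \<open>e\<close> with \<open>d\<close>, the witnesses of weak commutativity, which is why
  the relations survive the passage from \<open>a\<close> and \<open>b\<close> to their quasinilpotent parts \<open>a'\<close> and \<open>b'\<close>.
\<close>

lemma is_gDrazin_inverse_mult_weakly_commutative:
  fixes a b x y :: "'a::complex_banach_algebra_1"
  assumes x: "is_gDrazin_inverse a x" and y: "is_gDrazin_inverse b y"
    and comm: "weakly_commutative a b"
  shows "is_gDrazin_inverse (a * b) (y * x)"
proof -
  note X = is_gDrazin_inverseD[OF x] and Y = is_gDrazin_inverseD[OF y]
  obtain c d where c: "a * b = c * a" "b * a = a * c" and d: "a * b = b * d" "b * a = d * b"
    using comm unfolding weakly_commutative_def weakly_commutative_left_def
      weakly_commutative_right_def by blast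
  have sqa: "a ^ 2 * b = b * a ^ 2" "a ^ 2 * c = c * a ^ 2"
    using c by (metis mult.assoc power2_eq_square)+
  have sqb: "b ^ 2 * a = a * b ^ 2" "b ^ 2 * d = d * b ^ 2"
    using d by (metis mult.assoc power2_eq_square)+
  define p e where "p = a * x" and "e = b * y"
  define P Q where "P = x ^ 2" and "Q = y ^ 2"
  have p: "p * p = p" "p * a = a * p" "p * b = b * p" "p * c = c * p"
    unfolding p_def
    using X(3,6) gDrazin_inverse_commutes_square(2)[OF x] sqa by metis+
  have e: "e * e = e" "e * b = b * e" "e * a = a * e" "e * d = d * e"
    unfolding e_def
    using Y(3,6) gDrazin_inverse_commutes_square(2)[OF y] sqb by metis+
  have pe: "p * e = e * p"
    using gDrazin_inverse_commutes[OF y p(3)[symmetric]] p(3)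
    unfolding e_def by (metis mult.assoc)
  have Pb: "P * b = b * P" and Qa: "Q * a = a * Q"
    unfolding P_def Q_def
    using gDrazin_inverse_commutes_square(1)[OF x sqa(1)]
      gDrazin_inverse_commutes_square(1)[OF y sqb(1)] .
  have Pa: "P * a = a * P" and xP: "x = P * a" and pP: "p = P * (a * a)"
    unfolding P_def p_def using X(1,7,8) by (metis mult.assoc power2_eq_square)+
  have Qb: "Q * b = b * Q" and yQ: "y = Q * b" and eQ: "e = Q * (b * b)"
    unfolding Q_def e_def using Y(1,7,8) by (metis mult.assoc power2_eq_square)+
  have "Q * P = P * Q"
    using gDrazin_inverse_commutes[OF y Pb[symmetric]]
    unfolding Q_def by (metis mult.assoc power2_eq_square)
  define z where "z = y * x"
  have z: "z = P * Q * (b * a)"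
    unfolding z_def xP yQ using \<open>Q * P = P * Q\<close> Pb by (metis mult.assoc)
  have pe_PQ: "p * e = P * Q * (a * a * (b * b))"
    unfolding pP eQ using Qa by (metis mult.assoc)
  have PQab: "P * Q * (a * b) = a * b * (P * Q)"
    using Pa Pb Qa Qb by (metis mult.assoc)
  have abz: "a * b * z = p * e"
  proof -
    have "a * b * z = P * Q * (a * (b ^ 2 * a))"
      unfolding z using PQab by (metis mult.assoc power2_eq_square)
    then show ?thesis unfolding pe_PQ sqb by (simp add: power2_eq_square mult.assoc)
  qed
  have zab: "z * (a * b) = p * e"
  proof -
    have "z * (a * b) = P * Q * (b * a ^ 2 * b)"
      unfolding z by (simp add: power2_eq_square mult.assoc)
    then show ?thesis
      unfolding pe_PQ sqa(1)[symmetric] by (simp add: power2_eq_square mult.assoc)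
  qed
  have "p * (e * z) = z"
  proof -
    have "e * y = y" "p * x = x"
      unfolding p_def e_def using X(1,2) Y(1,2) by (metis mult.assoc)+
    moreover have "p * y = y * p"
      using gDrazin_inverse_commutes[OF y p(3)[symmetric]] by simp
    ultimately show ?thesis unfolding z_def by (metis mult.assoc)
  qed
  define a' b' where "a' = a * (1 - p)" and "b' = b * (1 - e)"
  have pab': "p * (a * b') = a * b' * p"
  proof -
    have "p * (1 - e) = (1 - e) * p" using pe by (simp add: algebra_simps)
    then show ?thesis unfolding b'_def using p(2,3) by (metis mult.assoc)
  qed
  have "quasinilpotent (a' * b)"
  proof (rule quasinilpotent_mult_weakly_commutative_left)
    show "quasinilpotent a'" unfolding a'_def p_def using X(4,5) by simp
    have "(1 - p) * b = b * (1 - p)" "(1 - p) * c = c * (1 - p)"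
      using p by (simp_all add: algebra_simps)
    then show "a' * b = c * a'" "b * a' = a' * c"
      unfolding a'_def using c by (metis mult.assoc)+
  qed
  moreover have "quasinilpotent (p * (a * b'))"
  proof (rule quasinilpotent_mult_commuting)
    show "quasinilpotent (a * b')"
    proof (rule quasinilpotent_mult_weakly_commutative_right)
      show "quasinilpotent b'" unfolding b'_def e_def using Y(4,5) by simp
      have "(1 - e) * a = a * (1 - e)" "(1 - e) * d = d * (1 - e)"
        using e by (simp_all add: algebra_simps)
      then show "a * b' = b' * d" "b' * a = d * b'"
        unfolding b'_def using d by (metis mult.assoc)+
    qed
    show "p * (a * b') = a * b' * p" by (rule pab')
  qed
  \<comment> \<open>The two parts are orthogonal, since the first lives in the corner of \<open>1 - p\<close>.\<close>
  moreover have "a' * b * (p * (a * b')) = 0"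
  proof -
    have "a' * p = 0" unfolding a'_def using p(1) by (simp add: mult.assoc left_diff_distrib)
    moreover have "a' * b * (p * (a * b')) = a' * p * (b * (a * b'))"
      using p(3) by (metis mult.assoc)
    ultimately show ?thesis by simp
  qed
  moreover have "p * (a * b') * (a' * b) = 0"
  proof -
    have "p * a' = a * (p - p * p)"
      unfolding a'_def using p(2) by (metis mult.assoc mult.right_neutral right_diff_distrib)
    then have "p * a' = 0" using p(1) by simp
    moreover have "p * (a * b') * (a' * b) = a * b' * (p * a') * b"
      using pab' by (metis mult.assoc)
    ultimately show ?thesis by simp
  qed
  ultimately have "quasinilpotent (a' * b + p * (a * b'))"
    by (rule quasinilpotent_add_orthogonal)
  also have "a' * b + p * (a * b') = a * b - (a * b) ^ 2 * z"
  proof -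
    have "(a * b) ^ 2 * z = a * b * (p * e)"
      using abz by (simp add: power2_eq_square mult.assoc)
    also have "\<dots> = p * a * b * e" using p by (metis mult.assoc)
    finally have rest: "(a * b) ^ 2 * z = p * a * b * e" .
    have "a' * b = (a - p * a) * b" unfolding a'_def using p(2) by (simp add: right_diff_distrib)
    then show ?thesis unfolding rest b'_def by (simp add: algebra_simps)
  qed
  finally show ?thesis
    using abz zab \<open>p * (e * z) = z\<close>
    unfolding is_gDrazin_inverse_def z_def[symmetric] by (simp add: mult.assoc)
qed

theorem theorem5p5:
  fixes a b :: "'a::complex_banach_algebra_1"
  assumes "gDrazin_invertible a" and "gDrazin_invertible b"
    and "weakly_commutative a b"
  shows "gDrazin_invertible (a * b) \<and>
         gDrazin_inverse (a * b) = gDrazin_inverse b * gDrazin_inverse a"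
proof -
  obtain x y where x: "is_gDrazin_inverse a x" and y: "is_gDrazin_inverse b y"
    using assms unfolding gDrazin_invertible_def by blast
  have "is_gDrazin_inverse (a * b) (y * x)"
    using is_gDrazin_inverse_mult_weakly_commutative[OF x y assms(3)] .
  then show ?thesis
    using gDrazin_inverse_eqI x y unfolding gDrazin_invertible_def by blast
qed

end
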